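(* Let $T\in\mathbb{B}(\mathcal{H})$ and $s,t\in \mathcal{PQ}(T)$ with $s>t$. Then $T$ is $(t+k(s-t))$-power quasinormal for every $k\in\mathbb{N}_{0}$.
   Context: $\mathbb{N}$ denotes the positive integers and $\mathbb{N}_0$ the nonnegative integers. $\mathbb{B}(\mathcal{H})$ is the algebra of bounded linear operators on a complex Hilbert space $\mathcal{H}$. Write $[S,T]=ST-TS$. For $n\in\mathbb{N}$, $T$ is $n$-power quasinormal if $[T^n,T^*T]=0$. The power-quasinormality index set of $T$ is $\mathcal{PQ}(T)=\{n\in\mathbb{N}:[T^n,T^\ast T]=0\}$. *)

theory Defs
  imports "HOL-Analysis.Analysis"
begin

section \<open>Complex Hilbert spaces\<close>

text \<open>A complex inner product space is presented on top of the library class \<^class>\<open>real_inner\<close>: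
  the real inner product is the real part of the complex one, so both induce the same norm
  and definiteness is inherited.  The complex inner product is linear in its first argument.\<close>

class complex_inner = real_inner +
  fixes scaleC :: "complex \<Rightarrow> 'a \<Rightarrow> 'a"
    and cinner :: "'a \<Rightarrow> 'a \<Rightarrow> complex"
  assumes scaleC_add_right: "scaleC c (x + y) = scaleC c x + scaleC c y"
    and scaleC_add_left: "scaleC (c + d) x = scaleC c x + scaleC d x"
    and scaleC_scaleC: "scaleC c (scaleC d x) = scaleC (c * d) x"
    and scaleC_of_real: "scaleC (complex_of_real r) x = scaleR r x"
    and cinner_add_left: "cinner (x + y) z = cinner x z + cinner y z"
    and cinner_scaleC_left: "cinner (scaleC c x) y = c * cinner x y"
    and cinner_commute: "cinner x y = cnj (cinner y x)"
    and Re_cinner: "Re (cinner x y) = inner x y"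

class chilbert_space = complex_inner + complete_space

instantiation complex :: chilbert_space
begin

definition scaleC_complex :: "complex \<Rightarrow> complex \<Rightarrow> complex"
  where "scaleC_complex c x = c * x"

definition cinner_complex :: "complex \<Rightarrow> complex \<Rightarrow> complex"
  where "cinner_complex x y = x * cnj y"

instance
  by standard
    (auto simp: scaleC_complex_def cinner_complex_def algebra_simps scaleR_conv_of_real
      inner_complex_def)

end

lemma cinner_self: "cinner x x = complex_of_real ((norm x)\<^sup>2)"
  for x :: "'a::complex_inner"
proof -
  have "Im (cinner x x) = - Im (cinner x x)"
    using arg_cong[OF cinner_commute[of x x], of Im] by simp
  then show ?thesis
    by (simp add: complex_eq_iff Re_cinner dot_square_norm)
qed

section \<open>Bounded operators and adjoints\<close>

definition bounded_clinear :: "('a::complex_inner \<Rightarrow> 'b::complex_inner) \<Rightarrow> bool"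
  where "bounded_clinear T \<longleftrightarrow> bounded_linear T \<and> (\<forall>c x. T (scaleC c x) = scaleC c (T x))"

definition is_cadjoint :: "('a::complex_inner \<Rightarrow> 'b::complex_inner) \<Rightarrow> ('b \<Rightarrow> 'a) \<Rightarrow> bool"
  where "is_cadjoint T S \<longleftrightarrow>
    bounded_clinear S \<and> (\<forall>x y. cinner (T x) y = cinner x (S y))"

text \<open>The description is justified by \<open>ex1_cadjoint\<close> below.\<close>

definition cadjoint :: "('a::chilbert_space \<Rightarrow> 'b::chilbert_space) \<Rightarrow> 'b \<Rightarrow> 'a"
  where "cadjoint T = (THE S. is_cadjoint T S)"

lemma riesz_representation_real:
  fixes f :: "'a::{real_inner,complete_space} \<Rightarrow> real"
  assumes "bounded_linear f"
  shows "\<exists>z. \<forall>x. f x = inner x z"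
proof -
  interpret f: bounded_linear f by fact
  obtain K where K: "\<And>x. norm (f x) \<le> norm x * K"
    using f.bounded by blast
  define J where "J x = inner x x - 2 * f x" for x
  define m where "m = Inf (range J)"
  have lower: "- K\<^sup>2 \<le> J x" for x
  proof -
    have "0 \<le> (norm x - K)\<^sup>2" by simp
    then show ?thesis
      using K[of x] by (simp add: J_def dot_square_norm power2_eq_square algebra_simps)
  qed
  then have bdd: "bdd_below (range J)"
    by (intro bdd_belowI[of _ "- K\<^sup>2"]) auto
  have m_le: "m \<le> J x" for x
    unfolding m_def by (rule cInf_lower[OF _ bdd]) auto
  have "\<exists>x. J x < m + 1 / real (Suc n)" for n
    using cInf_lessD[of "range J" "m + 1 / real (Suc n)"] by (auto simp: m_def)
  then obtain X where X: "\<And>n. J (X n) < m + 1 / real (Suc n)"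
    by metis
  have parallelogram: "(norm (x - y))\<^sup>2 \<le> 2 * (J x + J y - 2 * m)" for x y
  proof -
    have "(norm (x - y))\<^sup>2 = 2 * (J x + J y - 2 * J ((1 / 2) *\<^sub>R (x + y)))"
      by (simp add: J_def f.add f.scaleR power2_norm_eq_inner inner_simps inner_commute
          algebra_simps)
    with m_le[of "(1 / 2) *\<^sub>R (x + y)"] show ?thesis by simp
  qed
  have "Cauchy X"
  proof (rule metric_CauchyI)
    fix e :: real assume e: "0 < e"
    then obtain N where N: "1 / real (Suc N) < e\<^sup>2 / 4"
      using nat_approx_posE[of "e\<^sup>2 / 4"] by auto
    have "dist (X i) (X j) < e" if "N \<le> i" "N \<le> j" for i j
    proof -
      have "1 / real (Suc i) \<le> 1 / real (Suc N)" "1 / real (Suc j) \<le> 1 / real (Suc N)"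
        using that by (auto intro!: divide_left_mono)
      with X[of i] X[of j] parallelogram[of "X i" "X j"] N
      have "(norm (X i - X j))\<^sup>2 < e\<^sup>2" by argo
      then show ?thesis
        using e by (simp add: dist_norm power_less_imp_less_base)
    qed
    then show "\<exists>N. \<forall>i\<ge>N. \<forall>j\<ge>N. dist (X i) (X j) < e" by blast
  qed
  then obtain z where z: "X \<longlonglongrightarrow> z"
    using Cauchy_convergent_iff convergent_def by blast
  have "(\<lambda>n. J (X n)) \<longlonglongrightarrow> J z"
    unfolding J_def by (intro tendsto_intros z f.tendsto)
  moreover have "(\<lambda>n. m + 1 / real (Suc n)) \<longlonglongrightarrow> m + 0"
    by (intro tendsto_intros LIMSEQ_Suc[OF lim_1_over_n])
  ultimately have "J z \<le> m"
    using LIMSEQ_le[of "\<lambda>n. J (X n)" "J z" "\<lambda>n. m + 1 / real (Suc n)" "m + 0"] X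
    by (auto intro: less_imp_le)
  then have min: "J z \<le> J y" for y
    using m_le order_trans by blast
  have "f x = inner x z" for x
  proof -
    define d where "d = inner x z - f x"
    define q where "q = inner x x + 1"
    have q: "q > 0" by (simp add: q_def add_nonneg_pos)
    have "0 \<le> 2 * t * d + t\<^sup>2 * inner x x" for t
      using min[of "z + t *\<^sub>R x"]
      by (simp add: J_def d_def f.add f.scaleR inner_simps inner_commute power2_eq_square
          algebra_simps)
    from this[of "- (d / q)"] have "0 \<le> 2 * (- (d / q)) * d + (- (d / q))\<^sup>2 * (q - 1)"
      by (simp add: q_def)
    also have "\<dots> = - (d\<^sup>2 / q) - d\<^sup>2 / q\<^sup>2"
      using q by (simp add: divide_simps power2_eq_square) (simp add: algebra_simps)
    finally have "0 \<le> - (d\<^sup>2 / q) - d\<^sup>2 / q\<^sup>2" .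
    moreover have "0 \<le> d\<^sup>2 / q\<^sup>2" "0 \<le> d\<^sup>2 / q" using q by auto
    ultimately have "d\<^sup>2 / q = 0" by linarith
    then show ?thesis using q by (simp add: d_def)
  qed
  then show ?thesis by blast
qed

lemma Im_cinner: "Im (cinner x y) = inner (scaleC (- \<i>) x) y"
  by (simp flip: Re_cinner add: cinner_scaleC_left)

lemma ex1_cadjoint:
  fixes T :: "'a::chilbert_space \<Rightarrow> 'b::chilbert_space"
  assumes "bounded_clinear T"
  shows "\<exists>!S. is_cadjoint T S"
proof (rule ex_ex1I)
  interpret T: bounded_linear T
    using assms by (simp add: bounded_clinear_def)
  have T_scaleC: "T (scaleC c x) = scaleC c (T x)" for c x
    using assms by (simp add: bounded_clinear_def)
  have "\<exists>z. \<forall>x. inner (T x) y = inner x z" for y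
    by (rule riesz_representation_real)
      (rule bounded_linear_compose[OF bounded_linear_inner_left T.bounded_linear_axioms])
  then obtain S where S: "\<And>x y. inner (T x) y = inner x (S y)"
    by metis
  have cS: "cinner (T x) y = cinner x (S y)" for x y
    by (simp add: complex_eq_iff Re_cinner Im_cinner S flip: T_scaleC)
  have inner_ext: "u = v" if "\<And>x. inner x u = inner x v" for u v :: 'a
  proof -
    have "inner (u - v) (u - v) = 0"
      using that[of "u - v"] by (simp only: inner_diff_right diff_self)
    then show ?thesis by simp
  qed
  have cinner_ext: "u = v" if "\<And>x. cinner x u = cinner x v" for u v :: 'a
    using that by (intro inner_ext) (metis Re_cinner)
  have cinner_scaleC_right: "cinner x (scaleC c y) = cnj c * cinner x y"
    for c and x y :: "'c::complex_inner"
    by (metis cinner_commute cinner_scaleC_left complex_cnj_mult)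
  obtain K where K: "K \<ge> 0" "\<And>x. norm (T x) \<le> norm x * K"
    using T.nonneg_bounded by blast
  have "bounded_linear S"
  proof (rule bounded_linear_intro)
    show "S (x + y) = S x + S y" for x y
      by (rule inner_ext) (simp add: inner_add_right flip: S)
    show "S (r *\<^sub>R x) = r *\<^sub>R S x" for r x
      by (rule inner_ext) (simp flip: S)
    show "norm (S y) \<le> norm y * K" for y
    proof (cases "S y = 0")
      case False
      have "norm (S y) * norm (S y) = inner (T (S y)) y"
        by (simp add: S dot_square_norm power2_eq_square)
      also have "\<dots> \<le> norm (T (S y)) * norm y" by (rule norm_cauchy_schwarz)
      also have "\<dots> \<le> norm (S y) * K * norm y" by (intro mult_right_mono K) simp
      finally have "norm (S y) * norm (S y) \<le> norm (S y) * (norm y * K)"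
        by (simp add: mult_ac)
      then show ?thesis using False by simp
    qed (simp add: K)
  qed
  moreover have "S (scaleC c y) = scaleC c (S y)" for c y
    by (rule cinner_ext) (simp add: cinner_scaleC_right flip: cS)
  ultimately show "\<exists>S. is_cadjoint T S"
    using cS by (auto simp: is_cadjoint_def bounded_clinear_def)
  show "S1 = S2" if "is_cadjoint T S1" "is_cadjoint T S2" for S1 S2
    using that by (intro ext cinner_ext) (metis is_cadjoint_def)
qed

lemma is_cadjoint_cadjoint: "bounded_clinear T \<Longrightarrow> is_cadjoint T (cadjoint T)"
  unfolding cadjoint_def by (rule theI'[OF ex1_cadjoint])

section \<open>Power quasinormality\<close>

definition commutator :: "('a::complex_inner \<Rightarrow> 'a) \<Rightarrow> ('a \<Rightarrow> 'a) \<Rightarrow> 'a \<Rightarrow> 'a"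
  where "commutator S T = (\<lambda>x. (S \<circ> T) x - (T \<circ> S) x)"

text \<open>The exponent is a positive integer by convention.\<close>

definition power_quasinormal :: "nat \<Rightarrow> ('a::chilbert_space \<Rightarrow> 'a) \<Rightarrow> bool"
  where "power_quasinormal n T \<longleftrightarrow> 0 < n \<and> commutator (T ^^ n) (cadjoint T \<circ> T) = (\<lambda>_. 0)"

definition PQ :: "('a::chilbert_space \<Rightarrow> 'a) \<Rightarrow> nat set"
  where "PQ T = {n. 0 < n \<and> commutator (T ^^ n) (cadjoint T \<circ> T) = (\<lambda>_. 0)}"

end

theory Submission imports Defs begin

text \<open>Write \<open>A\<close> for \<open>T\<^sup>* T\<close> and \<open>d = s - t\<close>. Since \<open>T\<^sup>s = T\<^sup>d T\<^sup>t\<close> and both \<open>T\<^sup>s\<close> and \<open>T\<^sup>t\<close> commute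
  with \<open>A\<close>, the maps \<open>T\<^sup>d\<close> and \<open>A\<close> commute on the range of \<open>T\<^sup>t\<close>:
  \<open>T\<^sup>d A T\<^sup>t = T\<^sup>d T\<^sup>t A = T\<^sup>s A = A T\<^sup>s = A T\<^sup>d T\<^sup>t\<close>.
  Every power of \<open>T\<close> with exponent at least \<open>t\<close> maps into that range, so commutation
  with \<open>A\<close> passes from the exponent \<open>t + k d\<close> to \<open>t + (k + 1) d\<close>.\<close>

lemma funpow_commute_arith_progression:
  fixes f g :: "'a \<Rightarrow> 'a"
  assumes t: "\<And>x. (f ^^ t) (g x) = g ((f ^^ t) x)"
    and td: "\<And>x. (f ^^ (t + d)) (g x) = g ((f ^^ (t + d)) x)"
  shows "(f ^^ (t + k * d)) (g x) = g ((f ^^ (t + k * d)) x)"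
proof (induction k)
  case 0
  then show ?case by (simp add: t)
next
  case (Suc k)
  have split: "(f ^^ (m + n)) y = (f ^^ n) ((f ^^ m) y)" for m n y
    by (metis add.commute comp_apply funpow_add)
  have on_range: "(f ^^ d) (g ((f ^^ t) y)) = g ((f ^^ d) ((f ^^ t) y))" for y
    using td[of y] by (simp add: split t)
  have exponent: "t + Suc k * d = (t + k * d) + d" by simp
  have in_range: "(f ^^ (t + k * d)) x = (f ^^ t) ((f ^^ (k * d)) x)"
    by (simp add: funpow_add)
  have "(f ^^ (t + Suc k * d)) (g x) = (f ^^ d) (g ((f ^^ (t + k * d)) x))"
    by (simp only: exponent split[of "t + k * d" d] Suc.IH)
  also have "\<dots> = g ((f ^^ d) ((f ^^ (t + k * d)) x))"
    by (simp only: in_range on_range)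
  also have "\<dots> = g ((f ^^ (t + Suc k * d)) x)"
    by (simp only: exponent split[of "t + k * d" d])
  finally show ?case .
qed

lemma commutator_eq_0_iff:
  "commutator S R = (\<lambda>_. 0) \<longleftrightarrow> (\<forall>x. S (R x) = R (S x))"
  by (simp add: commutator_def fun_eq_iff)

theorem corollary3p5:
  fixes T :: "'a::chilbert_space \<Rightarrow> 'a" and s t :: nat
  assumes "bounded_clinear T"
    and "s \<in> PQ T" and "t \<in> PQ T"
    and "s > t"
  shows "\<forall>k::nat. power_quasinormal (t + k * (s - t)) T"
proof
  fix k :: nat
  let ?A = "cadjoint T \<circ> T"
  have "0 < t" and t: "(T ^^ t) (?A x) = ?A ((T ^^ t) x)" for x
    using assms(3) unfolding PQ_def commutator_eq_0_iff by blast+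
  have "(T ^^ s) (?A x) = ?A ((T ^^ s) x)" for x
    using assms(2) unfolding PQ_def commutator_eq_0_iff by blast
  moreover have "t + (s - t) = s" using assms(4) by simp
  ultimately have "(T ^^ (t + (s - t))) (?A x) = ?A ((T ^^ (t + (s - t))) x)" for x
    by simp
  from funpow_commute_arith_progression[of t T ?A "s - t", OF t this] \<open>0 < t\<close>
  show "power_quasinormal (t + k * (s - t)) T"
    unfolding power_quasinormal_def commutator_eq_0_iff by blast
qed

end
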